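(* Let $\mathcal{Q}$ be a hyperbolic polar space of rank $r\ge 1$ over $\mathbb{F}_q$ (type $\Omega^+(q)$), and let $D$ be an $(r-1)$-$(r,r,1)_{\Omega^+(q)}$ Steiner system in $\mathcal{Q}$. Then $D$ is a Latin-Greek halving of $\mathcal{Q}$, i.e. $D$ is one of the two classes (Latins or Greeks) of generators of $\mathcal{Q}$.
   Context: Let $q$ be a prime power. The hyperbolic polar space $\mathcal{Q}=\Omega^+(2r,q)$ of rank $r$ consists of all totally singular subspaces of a $2r$-dimensional $\mathbb{F}_q$-vector space $V$ equipped with a non-singular quadratic form of hyperbolic type (Witt index $r$). All dimensions are vector space dimensions. The $r$-dimensional subspaces of $\mathcal{Q}$ are called generators. For $t,k\in\{0,\ldots,r\}$ and an integer $\lambda\ge 0$, a $t$-$(r,k,\lambda)_{\Omega^+(q)}$ design in $\mathcal{Q}$ is a set $D$ of $k$-dimensional subspaces of $\mathcal{Q}$ (called blocks) such that every $t$-dimensional subspace of $\mathcal{Q}$ is contained in exactly $\lambda$ elements of $D$. A Steiner system is a design with $\lambda=1$. Latin-Greek halvings: on the set of generators of $\mathcal{Q}$, the relation "$r-\dim(B\cap B')$ is even" is an equivalence relation with exactly two classes, called the Latins and the Greeks. Each of the two classes is an $(r-1)$-$(r,r,1)_{\Omega^+(q)}$ design; each of them is called a Latin-Greek halving (or Latin-Greek design). *)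

theory Defs
  imports Complex_Main
begin

locale quadratic_space = vector_space scale
  for scale :: "'a::field \<Rightarrow> 'v::ab_group_add \<Rightarrow> 'v" (infixr \<open>*s\<close> 75) +
  fixes Q :: "'v \<Rightarrow> 'a"
  assumes Q_scale: "Q (a *s v) = a\<^sup>2 * Q v"
    (* The form below is symmetric, so linearity in one argument is bilinearity. *)
    and Q_polarization_linear:
      "Vector_Spaces.linear scale (*) (\<lambda>v. Q (u + v) - Q u - Q v)"
begin

definition polar_form :: "'v \<Rightarrow> 'v \<Rightarrow> 'a" where
  "polar_form u v = Q (u + v) - Q u - Q v"

(* In characteristic 2 the form Q is not determined by its polar form, hence the condition
   Q v = 0 on the radical. *)
definition nonsingular :: bool where
  "nonsingular \<longleftrightarrow> (\<forall>v. Q v = 0 \<and> (\<forall>u. polar_form u v = 0) \<longrightarrow> v = 0)"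

definition totally_singular :: "'v set \<Rightarrow> bool" where
  "totally_singular U \<longleftrightarrow> (\<forall>v\<in>U. Q v = 0)"

definition polar_space :: "'v set set" where
  "polar_space = {U. subspace U \<and> totally_singular U}"

definition witt_index :: nat where
  "witt_index = Max (dim ` polar_space)"

end

locale hyperbolic_polar_space = quadratic_space scale Q
  for scale :: "'a::{field,finite} \<Rightarrow> 'v::ab_group_add \<Rightarrow> 'v" (infixr \<open>*s\<close> 75)
    and Q :: "'v \<Rightarrow> 'a" +
  fixes r :: nat
    (* dim is 0 on infinite-dimensional spaces, so finiteness is stated separately. *)
  assumes finite_dimensional: "\<exists>A. finite A \<and> span A = UNIV"
    and dim_UNIV: "dim UNIV = 2 * r"
    and nonsingular: "nonsingular"
    and witt_index: "witt_index = r"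
begin

definition polar_subspaces :: "nat \<Rightarrow> 'v set set" where
  "polar_subspaces k = {U \<in> polar_space. dim U = k}"

definition generators :: "'v set set" where
  "generators = polar_subspaces r"

(* D is a t-(r, k, l) design; the rank r is the locale parameter. *)
definition design :: "nat \<Rightarrow> nat \<Rightarrow> nat \<Rightarrow> 'v set set \<Rightarrow> bool" where
  "design t k l D \<longleftrightarrow>
     t \<le> r \<and> k \<le> r \<and> D \<subseteq> polar_subspaces k \<and>
     (\<forall>T \<in> polar_subspaces t. card {B \<in> D. T \<subseteq> B} = l)"

definition latin_greek_rel :: "('v set \<times> 'v set) set" where
  "latin_greek_rel =
     {(B, B'). B \<in> generators \<and> B' \<in> generators \<and> even (r - dim (B \<inter> B'))}"

definition latin_greek_halvings :: "'v set set set" where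
  "latin_greek_halvings = generators // latin_greek_rel"

end

end

theory Submission imports Defs begin

text \<open>
  Call two generators adjacent if they meet in dimension \<open>r - 1\<close>. The totally singular subspace
  \<open>T\<close> in which two adjacent generators meet lies in no third generator, because
  \<open>T\<^sup>\<bottom>\<close> modulo \<open>T\<close> is a hyperbolic line; hence a Steiner system \<open>D\<close> contains exactly one of them.
  If \<open>B \<noteq> C\<close> are generators and \<open>c \<in> C - B\<close>, then \<open>\<langle>B \<inter> c\<^sup>\<bottom>, c\<rangle>\<close> is
  adjacent to \<open>B\<close> and meets \<open>C\<close> in one dimension more than \<open>B\<close> does. Walking from \<open>B\<close> to a
  block \<open>C \<in> D\<close> in this way, membership in \<open>D\<close> flips at each step, so \<open>B \<in> D\<close> iff
  \<open>r - dim (B \<inter> C)\<close> is even.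
\<close>

section \<open>Polar form and perpendicular spaces\<close>

context quadratic_space
begin

lemma linear_polar_form: "Vector_Spaces.linear scale (*) (polar_form u)"
  using Q_polarization_linear[of u] by (simp add: polar_form_def[abs_def])

lemma polar_form_commute: "polar_form u v = polar_form v u"
  by (simp add: polar_form_def add.commute)

lemma polar_form_add_right: "polar_form u (v + w) = polar_form u v + polar_form u w"
  and polar_form_diff_right: "polar_form u (v - w) = polar_form u v - polar_form u w"
  and polar_form_scale_right: "polar_form u (a *s v) = a * polar_form u v"
  and polar_form_zero_right: "polar_form u 0 = 0"
proof -
  interpret L: Vector_Spaces.linear scale "(*)" "polar_form u"
    by (rule linear_polar_form)
  show "polar_form u (v + w) = polar_form u v + polar_form u w" by (rule L.add)
  show "polar_form u (v - w) = polar_form u v - polar_form u w" by (rule L.diff)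
  show "polar_form u (a *s v) = a * polar_form u v" by (rule L.scale)
  show "polar_form u 0 = 0" by (rule L.zero)
qed

lemma polar_form_add_left: "polar_form (u + v) w = polar_form u w + polar_form v w"
  and polar_form_diff_left: "polar_form (u - v) w = polar_form u w - polar_form v w"
  and polar_form_scale_left: "polar_form (a *s u) w = a * polar_form u w"
  and polar_form_zero_left: "polar_form 0 w = 0"
  by (simp_all add: polar_form_commute[of _ w] polar_form_add_right polar_form_diff_right
      polar_form_scale_right polar_form_zero_right)

lemmas polar_form_linear_simps =
  polar_form_add_right polar_form_diff_right polar_form_scale_right polar_form_zero_right
  polar_form_add_left polar_form_diff_left polar_form_scale_left polar_form_zero_left

lemma Q_add: "Q (u + v) = Q u + Q v + polar_form u v"
  by (simp add: polar_form_def)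

lemma polar_form_eq_0_if_totally_singular:
  assumes "subspace U" "totally_singular U" "u \<in> U" "v \<in> U"
  shows "polar_form u v = 0"
  using assms subspace_add[of U u v] by (simp add: polar_form_def totally_singular_def)

text \<open>Defined for arbitrary sets, since it is applied to single vectors and to parts of a
  basis as well as to subspaces.\<close>

definition perp :: "'v set \<Rightarrow> 'v set" where
  "perp W = {v. \<forall>w\<in>W. polar_form v w = 0}"

lemma subspace_perp: "subspace (perp W)"
  by (auto simp: subspace_def perp_def polar_form_linear_simps)

text \<open>On \<open>k *s c + u\<close> with \<open>u\<close> in \<open>U\<close>, the form
  \<open>Q\<close> splits into the contributions of \<open>Q c\<close>, \<open>Q u\<close> and
  \<open>polar_form c u\<close>, which all vanish.\<close>

lemma totally_singular_span_insert:
  assumes "subspace U" "totally_singular U" "c \<in> perp U" "Q c = 0"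
  shows "totally_singular (span (insert c U))"
  unfolding totally_singular_def
proof
  fix x assume "x \<in> span (insert c U)"
  then obtain k where k: "x - k *s c \<in> U"
    using assms(1) by (auto simp: span_insert span_eq_iff[THEN iffD2])
  have "Q (k *s c + (x - k *s c)) = 0"
    using k assms by (simp only: Q_add Q_scale) (simp add: perp_def totally_singular_def
        polar_form_scale_left)
  then show "Q x = 0" by simp
qed

end

section \<open>Dimensions of perpendicular spaces\<close>

locale finite_dimensional_quadratic_space =
  quadratic_space scale Q + finite_dimensional_vector_space scale Basis
  for scale :: "'a::field \<Rightarrow> 'v::ab_group_add \<Rightarrow> 'v" (infixr \<open>*s\<close> 75)
    and Q :: "'v \<Rightarrow> 'a" and Basis :: "'v set"
begin

lemma dim_insert_subspace:
  assumes "subspace S" "x \<notin> S"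
  shows "dim (insert x S) = dim S + 1"
  using assms span_eq_iff[of S] by (metis dim_insert)

text \<open>\<open>S \<inter> perp {w}\<close> is the kernel of the functional
  \<open>\<lambda>s. polar_form s w\<close> on \<open>S\<close>, so its codimension in
  \<open>S\<close> is at most 1.\<close>

lemma dim_le_dim_Int_perp_singleton:
  assumes "subspace S"
  shows "dim S \<le> dim (S \<inter> perp {w}) + 1"
proof (cases "S \<subseteq> perp {w}")
  case True
  then show ?thesis by (simp add: Int_absorb2)
next
  case False
  then obtain s where s: "s \<in> S" "polar_form s w \<noteq> 0" by (auto simp: perp_def)
  have "S \<subseteq> span (insert s (S \<inter> perp {w}))"
  proof
    fix x assume x: "x \<in> S"
    let ?k = "polar_form x w / polar_form s w"
    have "x - ?k *s s \<in> S \<inter> perp {w}"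
      using x s assms by (auto simp: perp_def polar_form_linear_simps subspace_diff subspace_scale)
    then show "x \<in> span (insert s (S \<inter> perp {w}))"
      by (auto simp: span_insert intro: span_base)
  qed
  then have "dim S \<le> dim (insert s (S \<inter> perp {w}))"
    by (metis dim_span dim_subset)
  then show ?thesis by (simp add: dim_insert split: if_splits)
qed

lemma dim_le_dim_Int_perp:
  assumes "finite W" "subspace S"
  shows "dim S \<le> dim (S \<inter> perp W) + card W"
  using assms(1)
proof (induction W)
  case empty
  then show ?case by (simp add: perp_def)
next
  case (insert w W)
  have "dim (S \<inter> perp W) \<le> dim ((S \<inter> perp W) \<inter> perp {w}) + 1"
    by (intro dim_le_dim_Int_perp_singleton subspace_inter assms subspace_perp)
  also have "(S \<inter> perp W) \<inter> perp {w} = S \<inter> perp (insert w W)"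
    by (auto simp: perp_def)
  finally show ?case using insert by simp
qed

text \<open>
  In characteristic 2 the polar form may be degenerate, but the radical of a non-singular form
  contains no nonzero singular vector, which suffices here.
\<close>

lemma dim_perp_totally_singular:
  assumes "nonsingular" "subspace T" "totally_singular T"
  shows "dim (perp T) + dim T \<le> dim UNIV"
proof (rule ccontr)
  assume neg: "\<not> ?thesis"
  obtain B where B: "B \<subseteq> perp T" "independent B" "perp T \<subseteq> span B" "card B = dim (perp T)"
    using basis_exists by blast
  \<comment> \<open>Only the vectors of \<open>E - B\<close> impose conditions on \<open>T\<close>,
    because \<open>B\<close> lies in \<open>perp T\<close>. Fewer than \<open>dim T\<close>
    conditions leave a nonzero \<open>t\<close> in \<open>T\<close> perpendicular to all of
    \<open>E\<close>, a singular vector in the radical.\<close>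
  define E where "E = extend_basis B"
  have E: "B \<subseteq> E" "independent E" "span E = UNIV"
    unfolding E_def
    using B extend_basis_superset independent_extend_basis span_extend_basis by auto
  have "finite E" using E(2) by (rule finiteI_independent)
  have "card E = dim UNIV" using E by (metis dim_span dim_eq_card_independent)
  then have "card (E - B) = dim UNIV - dim (perp T)"
    using E(1) B(4) \<open>finite E\<close> by (simp add: card_Diff_subset finite_subset)
  moreover have "dim (perp T) \<le> dim UNIV" by (rule dim_subset) simp
  ultimately have "card (E - B) < dim T" using neg by linarith
  moreover have "dim T \<le> dim (T \<inter> perp (E - B)) + card (E - B)"
    using \<open>finite E\<close> assms(2) by (intro dim_le_dim_Int_perp) auto
  ultimately have "dim (T \<inter> perp (E - B)) \<noteq> 0" by linarith
  then obtain t where t: "t \<in> T" "t \<in> perp (E - B)" "t \<noteq> 0"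
    by (auto simp: dim_eq_0)
  have "E \<subseteq> perp {t}"
  proof
    fix x assume "x \<in> E"
    then have "polar_form x t = 0 \<or> polar_form t x = 0"
      using t B(1) by (cases "x \<in> B") (auto simp: perp_def)
    then have "polar_form x t = 0" using polar_form_commute by metis
    then show "x \<in> perp {t}" by (simp add: perp_def)
  qed
  then have "span E \<subseteq> perp {t}" by (intro span_minimal subspace_perp)
  then have "\<forall>u. polar_form u t = 0" using E(3) by (auto simp: perp_def)
  moreover have "Q t = 0" using t(1) assms(3) by (simp add: totally_singular_def)
  ultimately show False
    using assms(1) t(3) by (auto simp: nonsingular_def polar_form_commute[of t])
qed

end

text \<open>The target locale needs a named finite basis. Extending the empty set gives a basis, and
  it is finite because an independent set is bounded by the finite spanning set.\<close>

sublocale hyperbolic_polar_space \<subseteq> finite_dimensional_quadratic_space scale Q "extend_basis {}"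
proof unfold_locales
  obtain A where A: "finite A" "span A = UNIV" using finite_dimensional by blast
  show "independent (extend_basis {})" "span (extend_basis {}) = UNIV"
    by (simp_all add: independent_extend_basis span_extend_basis independent_empty)
  then show "finite (extend_basis {})"
    using A independent_span_bound[of A "extend_basis {}"] by simp
qed

section \<open>Generators and their intersections\<close>

context hyperbolic_polar_space
begin

text \<open>Makes the \<open>Max\<close> in \<open>witt_index\<close> a genuine maximum.\<close>

lemma finite_dim_polar_space: "finite (dim ` polar_space)"
proof (rule finite_subset)
  show "dim ` polar_space \<subseteq> {..dim UNIV}" using dim_subset[OF subset_UNIV] by auto
qed simp

lemma dim_totally_singular_le:
  assumes "subspace U" "totally_singular U"
  shows "dim U \<le> r"
  using Max_ge[OF finite_dim_polar_space, of "dim U"] assms witt_index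
  by (auto simp: witt_index_def polar_space_def)

lemma generators_iff: "U \<in> generators \<longleftrightarrow> subspace U \<and> totally_singular U \<and> dim U = r"
  by (auto simp: generators_def polar_subspaces_def polar_space_def)

lemma generators_nonempty: "generators \<noteq> {}"
proof -
  have "{0} \<in> polar_space"
    using Q_scale[of 0 0] by (simp add: polar_space_def totally_singular_def subspace_single_0)
  then have "Max (dim ` polar_space) \<in> dim ` polar_space"
    using finite_dim_polar_space by (intro Max_in) auto
  then obtain U where "U \<in> polar_space" "dim U = r"
    using witt_index by (metis (no_types, lifting) imageE witt_index_def)
  then have "U \<in> generators" by (simp add: generators_iff polar_space_def)
  then show ?thesis by blast
qed

text \<open>Subspaces of a generator inherit total singularity. The case \<open>k = r - 1\<close>
  yields a block of a Steiner system.\<close>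

lemma polar_subspaces_nonempty:
  assumes "k \<le> r"
  shows "polar_subspaces k \<noteq> {}"
proof -
  obtain U where U: "subspace U" "totally_singular U" "dim U = r"
    using generators_nonempty generators_iff by blast
  then obtain T where "subspace T" "T \<subseteq> span U" "dim T = k"
    using assms by (metis choose_subspace_of_subspace)
  moreover have "span U = U" using U by simp
  ultimately show ?thesis
    using U by (auto simp: polar_subspaces_def polar_space_def totally_singular_def)
qed

lemma generators_eqI:
  assumes "A \<in> generators" "B \<in> generators" "A \<subseteq> B"
  shows "A = B"
  using assms subspace_dim_equal[of A B] by (simp add: generators_iff)

text \<open>Otherwise \<open>c\<close> and \<open>B\<close> would span a totally singular subspace
  of dimension \<open>r + 1\<close>, beyond the Witt index.\<close>

lemma singular_in_generator:
  assumes "B \<in> generators" "Q c = 0" "c \<in> perp B"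
  shows "c \<in> B"
proof (rule ccontr)
  assume "c \<notin> B"
  moreover have "subspace B" "dim B = r" using assms(1) by (simp_all add: generators_iff)
  ultimately have "dim (span (insert c B)) = r + 1" by (simp add: dim_insert_subspace)
  moreover have "dim (span (insert c B)) \<le> r"
    using assms by (intro dim_totally_singular_le totally_singular_span_insert)
      (auto simp: generators_iff)
  ultimately show False by simp
qed

text \<open>Modulo \<open>T\<close>, the space \<open>perp T\<close> is a hyperbolic line spanned by
  some \<open>b\<close> in \<open>B\<close> and \<open>b'\<close> in \<open>B'\<close>, and its only
  singular points are these two.\<close>

lemma generator_containing_hyperplane:
  assumes T: "subspace T" "dim T + 1 = r"
    and gens: "B \<in> generators" "B' \<in> generators" "X \<in> generators" and "B \<noteq> B'"
    and sub: "T \<subseteq> B" "T \<subseteq> B'" "T \<subseteq> X"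
  shows "X = B \<or> X = B'"
proof -
  have sub_insert: "Y = span (insert y T)" if "Y \<in> generators" "T \<subseteq> Y" "y \<in> Y" "y \<notin> T" for Y y
  proof -
    have "span (insert y T) \<subseteq> Y"
      using that by (intro span_minimal) (auto simp: generators_iff)
    moreover have "dim (span (insert y T)) = r"
      using that T by (simp add: dim_insert_subspace)
    ultimately show ?thesis
      using that subspace_dim_equal[of "span (insert y T)" Y] by (simp add: generators_iff)
  qed
  have pf: "polar_form u v = 0" if "Y \<in> generators" "u \<in> Y" "v \<in> Y" for Y u v
    using that by (auto simp: generators_iff intro: polar_form_eq_0_if_totally_singular)
  have sing: "Q y = 0" if "Y \<in> generators" "y \<in> Y" for Y y
    using that by (auto simp: generators_iff totally_singular_def)
  obtain b where b: "b \<in> B" "b \<notin> B'" using generators_eqI gens \<open>B \<noteq> B'\<close> by blast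
  obtain b' where b': "b' \<in> B'" "b' \<notin> B" using generators_eqI gens \<open>B \<noteq> B'\<close> by blast
  have B: "B = span (insert b T)" using sub_insert b gens sub by blast
  have "\<not> X \<subseteq> T" using gens(3) T dim_subset[of X T] by (auto simp: generators_iff)
  then obtain x where x: "x \<in> X" "x \<notin> T" by blast
  \<comment> \<open>Otherwise \<open>b'\<close> would be perpendicular to \<open>T\<close> and
    \<open>b\<close>, hence to \<open>B\<close>, and would lie in \<open>B\<close> by
    maximality.\<close>
  have "polar_form b b' \<noteq> 0"
  proof
    assume "polar_form b b' = 0"
    then have "insert b T \<subseteq> perp {b'}"
      using pf[OF gens(2) _ b'(1)] sub by (auto simp: perp_def)
    then have "B \<subseteq> perp {b'}" unfolding B by (intro span_minimal subspace_perp)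
    then have "b' \<in> perp B" by (auto simp: perp_def polar_form_commute[of b'])
    then show False using singular_in_generator[of B b'] sing gens b' by blast
  qed
  \<comment> \<open>\<open>S\<close> lies in \<open>perp T\<close> and has dimension
    \<open>r + 1\<close>. As \<open>perp T\<close> has dimension at most
    \<open>2 * r - (r - 1)\<close>, the two coincide.\<close>
  define S where "S = span (insert b' (insert b T))"
  have "S \<subseteq> perp T" unfolding S_def
    using pf gens sub b b' by (intro span_minimal subspace_perp) (auto simp: perp_def)
  moreover have "b \<notin> T" using b sub by blast
  then have "dim S = r + 1"
    using b'(2) T B by (simp add: S_def dim_insert[of b'] dim_insert_subspace)
  moreover have "dim (perp T) \<le> r + 1"
  proof -
    have "totally_singular T" using sing gens(1) sub(1) by (auto simp: totally_singular_def)
    then show ?thesis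
      using dim_perp_totally_singular[OF nonsingular T(1)] T dim_UNIV by simp
  qed
  ultimately have "S = perp T"
    by (intro subspace_dim_equal) (auto simp: S_def subspace_perp)
  moreover have "x \<in> perp T" using pf gens sub x by (auto simp: perp_def)
  ultimately have "x \<in> S" by simp
  then obtain k' k where "x - k' *s b' - k *s b \<in> T"
    unfolding S_def span_insert span_eq_iff[THEN iffD2, OF T(1)] by auto
  then obtain t where t: "t \<in> T" "x = t + k *s b + k' *s b'"
    by (metis add.commute diff_add_cancel)
  have "Q x = k * k' * polar_form b b'"
  proof -
    have "t \<in> B" "t \<in> B'" using t(1) sub by auto
    then have "Q t = 0" "Q b = 0" "Q b' = 0" "polar_form t b = 0" "polar_form t b' = 0"
      using sing pf gens b b' by blast+
    then show ?thesis
      unfolding t(2) by (simp add: Q_add Q_scale polar_form_linear_simps)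
  qed
  then have "k = 0 \<or> k' = 0"
    using \<open>polar_form b b' \<noteq> 0\<close> sing[OF gens(3) x(1)] by simp
  then have "x = t + k' *s b' \<or> x = t + k *s b" using t(2) by auto
  moreover have "t + k *s b \<in> B" "t + k' *s b' \<in> B'"
    using t(1) sub b b' gens by (auto simp: generators_iff intro!: subspace_add subspace_scale)
  ultimately have "x \<in> B \<or> x \<in> B'" by blast
  then show ?thesis using sub_insert x gens sub by metis
qed

lemma generator_towards:
  assumes gens: "B \<in> generators" "C \<in> generators" and "B \<noteq> C"
  obtains A where "A \<in> generators" "A \<noteq> B" "dim (A \<inter> B) + 1 = r"
    "dim (A \<inter> C) = dim (B \<inter> C) + 1"
proof -
  obtain c where c: "c \<in> C" "c \<notin> B" using generators_eqI gens \<open>B \<noteq> C\<close> by blast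
  have spB: "subspace B" "totally_singular B" "dim B = r"
    and spC: "subspace C" "totally_singular C"
    using gens by (auto simp: generators_iff)
  define H where "H = B \<inter> perp {c}"
  define A where "A = span (insert c H)"
  have H: "subspace H" "totally_singular H" "span H = H"
    using spB by (auto simp: H_def subspace_inter subspace_perp totally_singular_def)
  have "subspace A" by (simp add: A_def)
  have "totally_singular A"
    unfolding A_def
  proof (rule totally_singular_span_insert)
    show "c \<in> perp H" by (simp add: perp_def H_def polar_form_commute)
    show "Q c = 0" using c spC by (simp add: totally_singular_def)
  qed fact+
  \<comment> \<open>One linear condition gives \<open>dim H \<ge> r - 1\<close>, and the Witt index
    bounds \<open>dim A = dim H + 1\<close> by \<open>r\<close>, so both are equalities.\<close>
  have "dim A = dim H + 1"
    using c H(1) by (simp add: A_def dim_insert_subspace H_def)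
  moreover have "dim A \<le> r"
    by (rule dim_totally_singular_le) fact+
  moreover have "r \<le> dim H + 1"
    using dim_le_dim_Int_perp_singleton[OF spB(1), of c] spB by (simp add: H_def)
  ultimately have "dim A = r" "dim H + 1 = r" by simp_all
  \<comment> \<open>Vectors of \<open>B \<inter> C\<close> are perpendicular to \<open>c\<close>
    because both lie in the totally singular \<open>C\<close>. So passing from \<open>B\<close> to
    \<open>A\<close> loses nothing of the intersection with \<open>C\<close>.\<close>
  have "H \<subseteq> B" "B \<inter> C \<subseteq> H"
    using polar_form_eq_0_if_totally_singular[OF spC _ c(1)] by (auto simp: H_def perp_def)
  have "A \<in> generators" using \<open>subspace A\<close> \<open>totally_singular A\<close> \<open>dim A = r\<close>
    by (simp add: generators_iff)
  moreover have "c \<in> A" by (simp add: A_def span_base)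
  then have "A \<noteq> B" using c by blast
  moreover have "A \<inter> B = H"
  proof (intro equalityI subsetI)
    fix x assume x: "x \<in> A \<inter> B"
    then obtain k where k: "x - k *s c \<in> H" using H by (auto simp: A_def span_insert)
    then have "x - (x - k *s c) \<in> B" using x \<open>H \<subseteq> B\<close> spB by (blast intro: subspace_diff)
    then have "k *s c \<in> B" by simp
    then have "inverse k *s k *s c \<in> B" using spB by (blast intro: subspace_scale)
    then have "k = 0" using c by (cases "k = 0") simp_all
    then show "x \<in> H" using k by simp
  next
    fix x assume "x \<in> H"
    then show "x \<in> A \<inter> B" using \<open>H \<subseteq> B\<close> by (auto simp: A_def intro: span_base)
  qed
  moreover have "A \<inter> C = span (insert c (B \<inter> C))"
  proof (intro equalityI subsetI)
    fix x assume x: "x \<in> A \<inter> C"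
    then obtain k where k: "x - k *s c \<in> H" using H by (auto simp: A_def span_insert)
    moreover have "x - k *s c \<in> C" using x c spC by (auto intro!: subspace_diff subspace_scale)
    ultimately have "x - k *s c \<in> span (B \<inter> C)" using \<open>H \<subseteq> B\<close> by (auto intro: span_base)
    then show "x \<in> span (insert c (B \<inter> C))" by (auto simp: span_insert)
  next
    have "span (insert c (B \<inter> C)) \<subseteq> C" using c spC by (intro span_minimal) auto
    moreover have "span (insert c (B \<inter> C)) \<subseteq> A"
      unfolding A_def using \<open>B \<inter> C \<subseteq> H\<close> by (intro span_mono) auto
    ultimately show "x \<in> A \<inter> C" if "x \<in> span (insert c (B \<inter> C))" for x
      using that by blast
  qed
  moreover have "subspace (B \<inter> C)" using spB spC by (simp add: subspace_inter)
  ultimately show thesis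
    using that[of A] c \<open>dim H + 1 = r\<close> by (simp add: dim_insert_subspace)
qed

section \<open>Steiner systems and the parity of intersections\<close>

lemma steiner_adjacent_iff:
  assumes D: "design (r - 1) r 1 D"
    and gens: "A \<in> generators" "B \<in> generators" "A \<noteq> B" and dim: "dim (A \<inter> B) + 1 = r"
  shows "B \<in> D \<longleftrightarrow> A \<notin> D"
proof -
  have T: "subspace (A \<inter> B)" "totally_singular (A \<inter> B)"
    using gens by (auto simp: generators_iff subspace_inter totally_singular_def)
  then have "A \<inter> B \<in> polar_subspaces (r - 1)"
    using dim by (simp add: polar_subspaces_def polar_space_def)
  then have "card {X \<in> D. A \<inter> B \<subseteq> X} = 1" using D by (simp add: design_def)
  then obtain X where X: "{X \<in> D. A \<inter> B \<subseteq> X} = {X}" by (rule card_1_singletonE)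
  then have "X \<in> D" "A \<inter> B \<subseteq> X" by blast+
  moreover have "X \<in> generators" using \<open>X \<in> D\<close> D by (auto simp: design_def generators_def)
  \<comment> \<open>The unique block \<open>X\<close> through \<open>A \<inter> B\<close> has only
    two candidates, so exactly one of \<open>A\<close> and \<open>B\<close> is a block.\<close>
  ultimately have "X = A \<or> X = B"
    using generator_containing_hyperplane[OF T(1) dim gens(1,2) _ gens(3)] by blast
  moreover have "Y = X" if "Y \<in> D" "A \<inter> B \<subseteq> Y" for Y using X that by blast
  ultimately show ?thesis using \<open>A \<noteq> B\<close> \<open>X \<in> D\<close> by blast
qed

text \<open>Induction on the distance \<open>r - dim (B \<inter> C)\<close>, with \<open>C\<close>
  fixed and \<open>B\<close> replaced by a neighbour one step closer to \<open>C\<close>.\<close>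

lemma steiner_mem_iff_even:
  assumes D: "design (r - 1) r 1 D" and "C \<in> D" and "B \<in> generators"
  shows "B \<in> D \<longleftrightarrow> even (r - dim (B \<inter> C))"
  using assms(3)
proof (induction "r - dim (B \<inter> C)" arbitrary: B)
  case 0
  have C: "C \<in> generators" using D \<open>C \<in> D\<close> by (auto simp: design_def generators_def)
  \<comment> \<open>Distance 0 means \<open>r \<le> dim (B \<inter> C)\<close>. If \<open>B\<close>
    and \<open>C\<close> differed, a step towards \<open>C\<close> would give a generator meeting
    \<open>C\<close> in dimension above \<open>r\<close>.\<close>
  have "B = C"
  proof (rule ccontr)
    assume "B \<noteq> C"
    then obtain A where "A \<in> generators" "dim (A \<inter> C) = dim (B \<inter> C) + 1"
      using generator_towards 0 C by metis
    moreover have "dim (A \<inter> C) \<le> dim A" by (intro dim_subset) auto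
    ultimately show False using 0 by (simp add: generators_iff)
  qed
  then show ?case using \<open>C \<in> D\<close> 0 by simp
next
  case (Suc n)
  have C: "C \<in> generators" using D \<open>C \<in> D\<close> by (auto simp: design_def generators_def)
  have "B \<noteq> C" using Suc.hyps(2) C by (auto simp: generators_iff)
  then obtain A where A: "A \<in> generators" "A \<noteq> B" "dim (A \<inter> B) + 1 = r"
    "dim (A \<inter> C) = dim (B \<inter> C) + 1"
    using generator_towards Suc.prems C by metis
  then have n: "n = r - dim (A \<inter> C)" using Suc.hyps(2) by simp
  have "B \<in> D \<longleftrightarrow> A \<notin> D"
    using steiner_adjacent_iff D A Suc.prems by blast
  also have "\<dots> \<longleftrightarrow> odd n" using Suc.hyps(1)[OF n A(1)] n by simp
  finally show ?case using Suc.hyps(2) by (metis even_Suc)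
qed

text \<open>Any block \<open>C\<close> can represent the class: by the parity criterion,
  \<open>D\<close> is exactly the set of generators related to \<open>C\<close>.\<close>

lemma steiner_latin_greek:
  assumes D: "design (r - 1) r 1 D"
  shows "D \<in> latin_greek_halvings"
proof -
  obtain T where "T \<in> polar_subspaces (r - 1)" using polar_subspaces_nonempty[of "r - 1"] by auto
  then have "card {B \<in> D. T \<subseteq> B} = 1" using D by (simp add: design_def)
  then obtain C where "C \<in> D" by (metis (lifting) card_1_singletonE mem_Collect_eq singletonI)
  have gen: "D \<subseteq> generators" using D by (auto simp: design_def generators_def)
  have "D = latin_greek_rel `` {C}"
    using steiner_mem_iff_even[OF D \<open>C \<in> D\<close>] gen \<open>C \<in> D\<close>
    by (auto simp: latin_greek_rel_def Int_commute)
  then show ?thesis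
    using gen \<open>C \<in> D\<close> by (auto simp: latin_greek_halvings_def quotient_def)
qed

end

theorem lemma14:
  fixes scale :: "'a::{field,finite} \<Rightarrow> 'v::ab_group_add \<Rightarrow> 'v"
    and Q :: "'v \<Rightarrow> 'a" and r :: nat and D :: "'v set set"
  assumes "hyperbolic_polar_space scale Q r"
    and "r \<ge> 1"
    and "hyperbolic_polar_space.design scale Q r (r - 1) r 1 D"
  shows "D \<in> hyperbolic_polar_space.latin_greek_halvings scale Q r"
  using hyperbolic_polar_space.steiner_latin_greek[OF assms(1,3)] .

end
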